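(* Let $m\geqslant 3$ and $n\geqslant 1$. Let $C_m$ be the cycle graph with vertices $v_0,\dots,v_{m-1}$ and edges $\{v_i,v_{i+1}\}$ ($0\le i\le m-2$) and $\{v_{m-1},v_0\}$, let $P_n$ be the path graph with vertices $v_0',\dots,v_{n-1}'$ and edges $\{v_j',v_{j+1}'\}$ ($0\le j\le n-2$), and let $\phi_{n,m}:P_n\to C_m$ be the map of graphs $\phi_{n,m}(v_j')=v_{j\bmod m}$. Then $\phi_{n,m}^*:G(C_m)\to G(P_n)$ is injective if and only if $n\geqslant 2m-2$.
   Context: For a graph $\Gamma$, $G(\Gamma)$ is the group with generating set $V(\Gamma)$ and relations $[u,v]=1$ whenever $\{u,v\}$ is NOT an edge of $\Gamma$. A map of graphs $\phi:\Lambda\to\Gamma$ (vertices to vertices, adjacent to adjacent) induces the homomorphism $\phi^*:G(\Gamma)\to G(\Lambda)$, $\phi^*(v)=\prod_{v'\in\phi^{-1}(v)}v'$ (identity if the fiber is empty; the factors pairwise commute). *)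

theory Defs
  imports "HOL-Algebra.Group"
begin

text \<open>A graph is given by a vertex set V and a symmetric, irreflexive adjacency
  predicate adj.  The group G(Gamma) is presented by generators V and relations
  [u,v] = 1 for every pair u, v that is NOT an edge.  We build it concretely as
  the quotient of the set of words over the letters V x bool (True = generator,
  False = its inverse) by the congruence generated by free cancellation and by
  the commutation relations.\<close>

type_synonym 'v letter = "'v \<times> bool"

inductive pres_step :: "'v set \<Rightarrow> ('v \<Rightarrow> 'v \<Rightarrow> bool) \<Rightarrow> 'v letter list \<Rightarrow> 'v letter list \<Rightarrow> bool"
  for V :: "'v set" and adj :: "'v \<Rightarrow> 'v \<Rightarrow> bool" where
  cancel: "v \<in> V \<Longrightarrow> pres_step V adj (xs @ [(v, b), (v, \<not> b)] @ ys) (xs @ ys)"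
| comm: "u \<in> V \<Longrightarrow> v \<in> V \<Longrightarrow> \<not> adj u v \<Longrightarrow>
     pres_step V adj (xs @ [(u, a), (v, c)] @ ys) (xs @ [(v, c), (u, a)] @ ys)"

definition word_eq :: "'v set \<Rightarrow> ('v \<Rightarrow> 'v \<Rightarrow> bool) \<Rightarrow> 'v letter list \<Rightarrow> 'v letter list \<Rightarrow> bool" where
  "word_eq V adj = equivclp (pres_step V adj)"

definition words :: "'v set \<Rightarrow> 'v letter list set" where
  "words V = lists (V \<times> UNIV)"

definition word_class :: "'v set \<Rightarrow> ('v \<Rightarrow> 'v \<Rightarrow> bool) \<Rightarrow> 'v letter list \<Rightarrow> 'v letter list set" where
  "word_class V adj w = {w' \<in> words V. word_eq V adj w w'}"

definition pres_group :: "'v set \<Rightarrow> ('v \<Rightarrow> 'v \<Rightarrow> bool) \<Rightarrow> ('v letter list set) monoid" where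
  "pres_group V adj =
     \<lparr> carrier = word_class V adj ` words V,
       mult = (\<lambda>X Y. word_class V adj ((SOME x. x \<in> X) @ (SOME y. y \<in> Y))),
       one = word_class V adj [] \<rparr>"

text \<open>Fibre of a vertex v of Gamma under phi, listed in some order (its elements
  pairwise commute in G(Lambda), so the order is irrelevant).\<close>
definition fibre_list :: "'w set \<Rightarrow> ('w \<Rightarrow> 'v) \<Rightarrow> 'v \<Rightarrow> 'w list" where
  "fibre_list V' \<phi> v = (SOME xs. distinct xs \<and> set xs = {v' \<in> V'. \<phi> v' = v})"

definition pb_letter :: "'w set \<Rightarrow> ('w \<Rightarrow> 'v) \<Rightarrow> 'v letter \<Rightarrow> 'w letter list" where
  "pb_letter V' \<phi> l =
     (if snd l then map (\<lambda>x. (x, True)) (fibre_list V' \<phi> (fst l))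
      else rev (map (\<lambda>x. (x, False)) (fibre_list V' \<phi> (fst l))))"

definition pb_word :: "'w set \<Rightarrow> ('w \<Rightarrow> 'v) \<Rightarrow> 'v letter list \<Rightarrow> 'w letter list" where
  "pb_word V' \<phi> w = concat (map (pb_letter V' \<phi>) w)"

definition pullback_hom ::
  "'v set \<Rightarrow> ('v \<Rightarrow> 'v \<Rightarrow> bool) \<Rightarrow> 'w set \<Rightarrow> ('w \<Rightarrow> 'w \<Rightarrow> bool) \<Rightarrow> ('w \<Rightarrow> 'v)
     \<Rightarrow> 'v letter list set \<Rightarrow> 'w letter list set" where
  "pullback_hom V adj V' adj' \<phi> X = word_class V' adj' (pb_word V' \<phi> (SOME w. w \<in> X))"

definition cycle_adj :: "nat \<Rightarrow> nat \<Rightarrow> nat \<Rightarrow> bool" where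
  "cycle_adj m i j \<longleftrightarrow> i < m \<and> j < m \<and> (j = (i + 1) mod m \<or> i = (j + 1) mod m)"

definition path_adj :: "nat \<Rightarrow> nat \<Rightarrow> nat \<Rightarrow> bool" where
  "path_adj n i j \<longleftrightarrow> i < n \<and> j < n \<and> (j = i + 1 \<or> i = j + 1)"

end

theory Submission
  imports Defs "HOL-Combinatorics.Transposition"
begin

text \<open>Words over the path are tested for triviality by reading them into stacks of uncancelled
  letters, one stack for each edge.  Suppose that a reduced word over the cycle becomes trivial when
  lifted to a path with at least \<open>2 * m - 2\<close> vertices, and that two letters \<open>m - 2\<close> cancel in the
  lift with no \<open>m - 2\<close> or \<open>m - 1\<close> in between.  Since the word is reduced, a letter \<open>m - 3\<close> occurs in
  between, and all of these must cancel among each other next to the lift \<open>m - 2\<close>; an innermost such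
  pair encloses a letter \<open>m - 4\<close>, and so on down to an innermost pair of letters \<open>0\<close> enclosing
  nothing.  Going up along \<open>m - 1, m, \<dots>, 2 * m - 3\<close> excludes cancelling letters \<open>m - 1\<close> in the same
  way, so no letter \<open>m - 2\<close> or \<open>m - 1\<close> ever cancels.  For shorter paths, the commutator of
  \<open>g (m - 3) g\<^sup>-\<^sup>1\<close> and \<open>m - 1\<close>, where \<open>g\<close> is the product \<open>0 1 \<dots> (m - 4)\<close>, is a nontrivial
  element of the kernel.\<close>

section \<open>Words modulo the defining relations\<close>

lemma word_eq_refl [simp]: "word_eq V adj w w"
  by (simp add: word_eq_def)

lemma word_eq_sym: "word_eq V adj x y \<Longrightarrow> word_eq V adj y x"
  by (simp add: word_eq_def equivclp_sym)

lemma word_eq_trans [trans]: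
  "word_eq V adj x y \<Longrightarrow> word_eq V adj y z \<Longrightarrow> word_eq V adj x z"
  unfolding word_eq_def by (rule equivclp_trans)

lemma word_eq_step: "pres_step V adj x y \<Longrightarrow> word_eq V adj x y"
  unfolding word_eq_def by (rule r_into_equivclp)

lemma word_eq_map:
  assumes "word_eq V adj x y"
    and "\<And>x y. pres_step V adj x y \<Longrightarrow> word_eq V' adj' (f x) (f y)"
  shows "word_eq V' adj' (f x) (f y)"
  using assms(1) unfolding word_eq_def
proof (induction rule: equivclp_induct)
  case base
  then show ?case by simp
next
  case (step y z)
  then have "word_eq V' adj' (f y) (f z)"
    using assms(2) word_eq_sym by blast
  with step.IH show ?case
    unfolding word_eq_def by (metis equivclp_trans)
qed

lemma word_eq_invariant:
  assumes "word_eq V adj x y" and "\<And>x y. pres_step V adj x y \<Longrightarrow> f x = f y"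
  shows "f x = f y"
  using assms(1) unfolding word_eq_def
  by (induction rule: equivclp_induct) (use assms(2) in metis)+

lemma word_eq_context:
  assumes "word_eq V adj x y"
  shows "word_eq V adj (p @ x @ q) (p @ y @ q)"
  using assms
proof (rule word_eq_map)
  fix x y
  assume "pres_step V adj x y"
  then have "pres_step V adj (p @ x @ q) (p @ y @ q)"
  proof cases
    case (cancel v xs b ys)
    then show ?thesis
      using pres_step.cancel[of v V adj "p @ xs" b "ys @ q"] by simp
  next
    case (comm u v xs a c ys)
    then show ?thesis
      using pres_step.comm[of u V v adj "p @ xs" a c "ys @ q"] by simp
  qed
  then show "word_eq V adj (p @ x @ q) (p @ y @ q)"
    by (rule word_eq_step)
qed

lemma word_eq_append:
  assumes "word_eq V adj x x'" "word_eq V adj y y'"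
  shows "word_eq V adj (x @ y) (x' @ y')"
  using word_eq_context[OF assms(1), of "[]" y] word_eq_context[OF assms(2), of x' "[]"]
  by (auto intro: word_eq_trans)

lemma word_eq_words:
  assumes "word_eq V adj x y"
  shows "x \<in> words V \<longleftrightarrow> y \<in> words V"
  using assms
  by (rule word_eq_invariant) (auto simp: words_def elim!: pres_step.cases)

lemma words_append [simp]: "x @ y \<in> words V \<longleftrightarrow> x \<in> words V \<and> y \<in> words V"
  by (auto simp: words_def)

lemma words_Nil [simp]: "[] \<in> words V"
  by (simp add: words_def)

lemma words_Cons [simp]: "l # w \<in> words V \<longleftrightarrow> fst l \<in> V \<and> w \<in> words V"
  by (cases l) (auto simp: words_def)

lemma words_iff: "w \<in> words V \<longleftrightarrow> (\<forall>l \<in> set w. fst l \<in> V)"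
  by (induction w) auto

section \<open>Formal inverses of words\<close>

definition inv_letter :: "'v letter \<Rightarrow> 'v letter" where
  "inv_letter l = (fst l, \<not> snd l)"

definition inv_word :: "'v letter list \<Rightarrow> 'v letter list" where
  "inv_word w = rev (map inv_letter w)"

lemma fst_inv_letter [simp]: "fst (inv_letter l) = fst l"
  by (simp add: inv_letter_def)

lemma inv_letter_inv_letter [simp]: "inv_letter (inv_letter l) = l"
  by (simp add: inv_letter_def)

lemma inv_word_simps [simp]:
  "inv_word [] = []"
  "inv_word (l # w) = inv_word w @ [inv_letter l]"
  "inv_word (x @ y) = inv_word y @ inv_word x"
  "inv_word (inv_word x) = x"
  by (simp_all add: inv_word_def rev_map o_def)

lemma set_inv_word: "set (inv_word w) = inv_letter ` set w"
  by (simp add: inv_word_def)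

lemma inv_word_words [simp]: "inv_word w \<in> words V \<longleftrightarrow> w \<in> words V"
  by (induction w) auto

lemma word_eq_cancel:
  assumes "fst l \<in> V"
  shows "word_eq V adj (p @ l # inv_letter l # q) (p @ q)"
  using word_eq_step[OF pres_step.cancel[OF assms, of adj p "snd l" q]]
  by (simp add: inv_letter_def)

lemma word_eq_inverse_right:
  assumes "w \<in> words V"
  shows "word_eq V adj (w @ inv_word w) []"
  using assms
proof (induction w rule: rev_induct)
  case (snoc l w)
  have "word_eq V adj (w @ l # inv_letter l # inv_word w) (w @ inv_word w)"
    by (rule word_eq_cancel) (use snoc.prems in simp)
  with snoc show ?case
    by (auto intro: word_eq_trans)
qed simp

lemma word_eq_inverse_left:
  assumes "w \<in> words V"
  shows "word_eq V adj (inv_word w @ w) []"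
  using word_eq_inverse_right[of "inv_word w" V adj] assms by simp

lemma word_eq_iff_quotient:
  assumes "y \<in> words V"
  shows "word_eq V adj x y \<longleftrightarrow> word_eq V adj (x @ inv_word y) []"
proof
  assume "word_eq V adj x y"
  then have "word_eq V adj (x @ inv_word y) (y @ inv_word y)"
    by (intro word_eq_append) auto
  also have "word_eq V adj \<dots> []"
    by (rule word_eq_inverse_right[OF assms])
  finally show "word_eq V adj (x @ inv_word y) []" .
next
  assume "word_eq V adj (x @ inv_word y) []"
  then have "word_eq V adj ((x @ inv_word y) @ y) ([] @ y)"
    by (intro word_eq_append) auto
  moreover have "word_eq V adj (x @ (inv_word y @ y)) (x @ [])"
    by (intro word_eq_append word_eq_inverse_left assms) auto
  ultimately show "word_eq V adj x y"
    using word_eq_sym word_eq_trans by fastforce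
qed

section \<open>Commuting words and reduced words\<close>

definition commuting :: "('v \<Rightarrow> 'v \<Rightarrow> bool) \<Rightarrow> 'v letter list \<Rightarrow> 'v letter list \<Rightarrow> bool" where
  "commuting adj x y \<longleftrightarrow> (\<forall>l \<in> set x. \<forall>l' \<in> set y. \<not> adj (fst l) (fst l'))"

lemma commuting_mono:
  "commuting adj x y \<Longrightarrow> set x' \<subseteq> set x \<Longrightarrow> set y' \<subseteq> set y \<Longrightarrow> commuting adj x' y'"
  by (fastforce simp: commuting_def)

lemma word_eq_commute_letter:
  assumes "l # y \<in> words V" "commuting adj [l] y"
  shows "word_eq V adj (l # y) (y @ [l])"
  using assms
proof (induction y)
  case (Cons k y)
  have "word_eq V adj ([] @ [l, k] @ y) ([] @ [k, l] @ y)"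
    using Cons.prems
      pres_step.comm[of "fst l" V "fst k" adj "[]" "snd l" "snd k" y]
    by (intro word_eq_step) (auto simp: commuting_def)
  also have "word_eq V adj ([k] @ (l # y)) ([k] @ (y @ [l]))"
    by (rule word_eq_append) (use Cons in \<open>auto simp: commuting_def\<close>)
  then have "word_eq V adj ([] @ [k, l] @ y) ([k] @ (y @ [l]))"
    by simp
  finally show ?case by simp
qed simp

lemma word_eq_commute:
  assumes "x \<in> words V" "y \<in> words V" "commuting adj x y"
  shows "word_eq V adj (x @ y) (y @ x)"
  using assms
proof (induction x)
  case (Cons l x)
  have "word_eq V adj ([l] @ (x @ y)) ([l] @ (y @ x))"
    by (rule word_eq_append) (use Cons in \<open>auto simp: commuting_def\<close>)
  also have "word_eq V adj ((l # y) @ x) ((y @ [l]) @ x)"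
    by (rule word_eq_append)
      (use Cons in \<open>auto simp: commuting_def intro!: word_eq_commute_letter\<close>)
  then have "word_eq V adj ([l] @ (y @ x)) ((y @ [l]) @ x)"
    by simp
  finally show ?case by simp
qed simp

lemma word_eq_cancel_commuting:
  assumes "l # y \<in> words V" "commuting adj [l] y"
  shows "word_eq V adj (p @ l # y @ inv_letter l # q) (p @ y @ q)"
proof -
  have "word_eq V adj (p @ (l # y) @ inv_letter l # q) (p @ (y @ [l]) @ inv_letter l # q)"
    by (intro word_eq_context word_eq_commute_letter assms)
  also have "word_eq V adj ((p @ y) @ l # inv_letter l # q) ((p @ y) @ q)"
    by (rule word_eq_cancel) (use assms in simp)
  then have "word_eq V adj (p @ (y @ [l]) @ inv_letter l # q) ((p @ y) @ q)"
    by simp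
  finally show ?thesis by simp
qed

text \<open>No two inverse letters can be brought together by commutations. In a loopless graph
  \<open>y\<close> may contain the vertex of \<open>l\<close> itself, as a vertex is not adjacent to
  itself.\<close>

definition reduced :: "('v \<Rightarrow> 'v \<Rightarrow> bool) \<Rightarrow> 'v letter list \<Rightarrow> bool" where
  "reduced adj w \<longleftrightarrow> \<not> (\<exists>p l y q. w = p @ l # y @ inv_letter l # q \<and> commuting adj [l] y)"

lemma reduced_factor:
  assumes "reduced adj (p @ w @ q)"
  shows "reduced adj w"
  unfolding reduced_def
proof clarify
  fix p' l y q'
  assume "w = p' @ l # y @ inv_letter l # q'" and c: "commuting adj [l] y"
  then have "p @ w @ q = (p @ p') @ l # y @ inv_letter l # (q' @ q)"
    by simp
  with c assms show False
    unfolding reduced_def by blast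
qed

lemma reduced_prefix: "reduced adj (w @ q) \<Longrightarrow> reduced adj w"
  using reduced_factor[of adj "[]" w q] by simp

lemma reduced_suffix: "reduced adj (p @ w) \<Longrightarrow> reduced adj w"
  using reduced_factor[of adj p w "[]"] by simp

text \<open>A representative of least length works: a cancellable pair would give a shorter
  one.\<close>

lemma exists_reduced:
  assumes "w \<in> words V"
  shows "\<exists>w'. word_eq V adj w w' \<and> reduced adj w'"
proof -
  obtain w' where eq: "word_eq V adj w w'"
    and min: "\<And>u. word_eq V adj w u \<Longrightarrow> length w' \<le> length u"
    using ex_has_least_nat[of "word_eq V adj w" w length] by auto
  have "reduced adj w'"
    unfolding reduced_def
  proof clarify
    fix p l y q
    assume w': "w' = p @ l # y @ inv_letter l # q" and c: "commuting adj [l] y"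
    have "w' \<in> words V"
      using word_eq_words[OF eq] assms by simp
    then have "word_eq V adj w' (p @ y @ q)"
      unfolding w' by (intro word_eq_cancel_commuting c) auto
    then show False
      using min[OF word_eq_trans[OF eq]] w' by fastforce
  qed
  with eq show ?thesis by blast
qed

section \<open>The pullback homomorphism and its kernel\<close>

lemma fibre_list:
  assumes "finite V'"
  shows "distinct (fibre_list V' \<phi> v)" "set (fibre_list V' \<phi> v) = {x \<in> V'. \<phi> x = v}"
proof -
  obtain xs where "distinct xs \<and> set xs = {x \<in> V'. \<phi> x = v}"
    using finite_distinct_list[of "{x \<in> V'. \<phi> x = v}"] assms by auto
  then have "distinct (fibre_list V' \<phi> v) \<and> set (fibre_list V' \<phi> v) = {x \<in> V'. \<phi> x = v}"
    unfolding fibre_list_def by (rule someI)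
  then show "distinct (fibre_list V' \<phi> v)" "set (fibre_list V' \<phi> v) = {x \<in> V'. \<phi> x = v}"
    by simp_all
qed

text \<open>Hides the reversal used for inverse letters; from here on only the set of lifts matters
  and that each occurs once.\<close>

lemma pb_letter_eq_map:
  assumes "finite V'"
  obtains xs where "pb_letter V' \<phi> l = map (\<lambda>x. (x, snd l)) xs" "distinct xs"
    "set xs = {x \<in> V'. \<phi> x = fst l}"
proof (cases "snd l")
  case True
  then show ?thesis
    using that[of "fibre_list V' \<phi> (fst l)"] fibre_list[OF assms, of \<phi> "fst l"] by (simp add: pb_letter_def)
next
  case False
  then show ?thesis
    using that[of "rev (fibre_list V' \<phi> (fst l))"] fibre_list[OF assms, of \<phi> "fst l"]
    by (simp add: pb_letter_def rev_map)
qed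

lemma set_pb_letter:
  assumes "finite V'"
  shows "set (pb_letter V' \<phi> l) = {x \<in> V'. \<phi> x = fst l} \<times> {snd l}"
  by (rule pb_letter_eq_map[OF assms, of \<phi> l]) auto

lemma pb_word_simps [simp]:
  "pb_word V' \<phi> [] = []"
  "pb_word V' \<phi> (l # w) = pb_letter V' \<phi> l @ pb_word V' \<phi> w"
  "pb_word V' \<phi> (x @ y) = pb_word V' \<phi> x @ pb_word V' \<phi> y"
  by (simp_all add: pb_word_def)

lemma set_pb_word:
  assumes "finite V'"
  shows "set (pb_word V' \<phi> w) = {(x, b). x \<in> V' \<and> (\<phi> x, b) \<in> set w}"
  by (auto simp: pb_word_def set_pb_letter[OF assms])

lemma pb_word_words [simp]: "finite V' \<Longrightarrow> pb_word V' \<phi> w \<in> words V'"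
  by (auto simp: words_iff set_pb_word)

lemma pb_letter_inv_letter: "pb_letter V' \<phi> (inv_letter l) = inv_word (pb_letter V' \<phi> l)"
  by (auto simp: pb_letter_def inv_letter_def inv_word_def rev_map o_def)

lemma pb_word_inv_word: "pb_word V' \<phi> (inv_word w) = inv_word (pb_word V' \<phi> w)"
  by (induction w) (simp_all add: pb_letter_inv_letter)

section \<open>Kernel of the pullback\<close>

lemma word_class_eq_iff:
  assumes "y \<in> words V"
  shows "word_class V adj x = word_class V adj y \<longleftrightarrow> word_eq V adj x y"
proof
  assume "word_class V adj x = word_class V adj y"
  then have "y \<in> word_class V adj x"
    using assms by (simp add: word_class_def)
  then show "word_eq V adj x y"
    by (simp add: word_class_def)
next
  assume "word_eq V adj x y"
  then show "word_class V adj x = word_class V adj y"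
    unfolding word_class_def by (metis word_eq_sym word_eq_trans)
qed

locale graph_map =
  fixes V :: "'v set" and adj and V' :: "'w set" and adj' and \<phi> :: "'w \<Rightarrow> 'v"
  assumes finite: "finite V'"
    and adj_map: "x \<in> V' \<Longrightarrow> y \<in> V' \<Longrightarrow> adj' x y \<Longrightarrow> adj (\<phi> x) (\<phi> y)"
begin

lemma commuting_pb_word:
  assumes "commuting adj x y"
  shows "commuting adj' (pb_word V' \<phi> x) (pb_word V' \<phi> y)"
  using assms adj_map by (fastforce simp: commuting_def set_pb_word[OF finite])

lemma word_eq_pb_word:
  assumes "word_eq V adj x y"
  shows "word_eq V' adj' (pb_word V' \<phi> x) (pb_word V' \<phi> y)"
  using assms
proof (rule word_eq_map)
  let ?pb = "pb_word V' \<phi>"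
  fix x y
  assume "pres_step V adj x y"
  then show "word_eq V' adj' (?pb x) (?pb y)"
  proof cases
    case (cancel v xs b ys)
    have "word_eq V' adj' (?pb [(v, b), inv_letter (v, b)]) []"
      using word_eq_inverse_right[of "?pb [(v, b)]" V' adj'] pb_word_words[OF finite, of \<phi> "[(v, b)]"]
      by (simp add: pb_letter_inv_letter)
    then have "word_eq V' adj' (?pb xs @ ?pb [(v, b), inv_letter (v, b)] @ ?pb ys) (?pb xs @ [] @ ?pb ys)"
      by (rule word_eq_context)
    with cancel show ?thesis
      by (simp add: inv_letter_def)
  next
    case (comm u v xs a c ys)
    have "commuting adj [(u, a)] [(v, c)]"
      using comm by (simp add: commuting_def)
    then have "word_eq V' adj' (?pb [(u, a)] @ ?pb [(v, c)]) (?pb [(v, c)] @ ?pb [(u, a)])"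
      by (intro word_eq_commute commuting_pb_word pb_word_words finite)
    then have "word_eq V' adj' (?pb xs @ (?pb [(u, a)] @ ?pb [(v, c)]) @ ?pb ys)
        (?pb xs @ (?pb [(v, c)] @ ?pb [(u, a)]) @ ?pb ys)"
      by (rule word_eq_context)
    with comm show ?thesis
      by simp
  qed
qed

text \<open>The representative picked by \<open>SOME\<close> is irrelevant, since
  \<open>word_eq_pb_word\<close> makes lifting well defined on classes.\<close>

lemma pullback_hom_word_class:
  assumes "w \<in> words V"
  shows "pullback_hom V adj V' adj' \<phi> (word_class V adj w) = word_class V' adj' (pb_word V' \<phi> w)"
proof -
  have "w \<in> word_class V adj w"
    using assms by (simp add: word_class_def)
  then have "(SOME u. u \<in> word_class V adj w) \<in> word_class V adj w"
    by (rule someI)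
  then have "word_eq V adj (SOME u. u \<in> word_class V adj w) w"
    by (auto simp: word_class_def word_eq_sym)
  from word_eq_pb_word[OF this] show ?thesis
    unfolding pullback_hom_def by (subst word_class_eq_iff) (auto simp: finite)
qed

text \<open>The usual kernel criterion, carried out on words: \<open>x\<close> and \<open>y\<close>
  have the same image iff \<open>x @ inv_word y\<close> lifts to a trivial word.\<close>

lemma inj_on_pullback_hom_iff:
  "inj_on (pullback_hom V adj V' adj' \<phi>) (carrier (pres_group V adj)) \<longleftrightarrow>
    (\<forall>w \<in> words V. word_eq V' adj' (pb_word V' \<phi> w) [] \<longrightarrow> word_eq V adj w [])"
    (is "?inj \<longleftrightarrow> ?ker")
proof -
  have eq_iff: "word_eq V' adj' (pb_word V' \<phi> x) (pb_word V' \<phi> y) \<longleftrightarrow>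
      word_eq V' adj' (pb_word V' \<phi> (x @ inv_word y)) []" for x y
    by (subst word_eq_iff_quotient) (simp_all add: finite pb_word_inv_word)
  have "?inj \<longleftrightarrow> (\<forall>x \<in> words V. \<forall>y \<in> words V.
      word_eq V' adj' (pb_word V' \<phi> x) (pb_word V' \<phi> y) \<longrightarrow> word_eq V adj x y)"
    by (auto simp: inj_on_def pres_group_def pullback_hom_word_class word_class_eq_iff finite)
  also have "\<dots> \<longleftrightarrow> ?ker"
  proof (intro iffI ballI impI)
    fix w
    assume "\<forall>x \<in> words V. \<forall>y \<in> words V.
      word_eq V' adj' (pb_word V' \<phi> x) (pb_word V' \<phi> y) \<longrightarrow> word_eq V adj x y"
      "w \<in> words V" "word_eq V' adj' (pb_word V' \<phi> w) []"
    then show "word_eq V adj w []"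
      by (metis words_Nil pb_word_simps(1))
  next
    fix x y
    assume "?ker" "x \<in> words V" "y \<in> words V"
      "word_eq V' adj' (pb_word V' \<phi> x) (pb_word V' \<phi> y)"
    then show "word_eq V adj x y"
      using eq_iff[of x y] word_eq_iff_quotient[of y V adj x] by simp
  qed
  finally show ?thesis .
qed

end

lemma cycle_adj_mod_iff:
  assumes "0 < m"
  shows "cycle_adj m (i mod m) (j mod m) \<longleftrightarrow> j mod m = Suc i mod m \<or> i mod m = Suc j mod m"
  using assms by (simp add: cycle_adj_def mod_Suc_eq)

lemma graph_map_path_cycle:
  assumes "0 < m"
  shows "graph_map (cycle_adj m) {..<n} (path_adj n) (\<lambda>j. j mod m)"
  by unfold_locales (auto simp: path_adj_def cycle_adj_mod_iff[OF assms])

section \<open>Pilings over a path\<close>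

text \<open>Column \<open>c\<close> stands for the edge between the vertices \<open>c - 1\<close> and \<open>c\<close> of the path (including two
  half-edges at the ends), so a letter acts on the two columns at its vertex and letters of
  non-adjacent vertices act on disjoint sets of columns.\<close>

definition pops :: "nat letter \<Rightarrow> (nat \<Rightarrow> nat letter list) \<Rightarrow> bool" where
  "pops l s \<longleftrightarrow>
    (s (fst l) \<noteq> [] \<and> hd (s (fst l)) = inv_letter l) \<and>
    (s (Suc (fst l)) \<noteq> [] \<and> hd (s (Suc (fst l))) = inv_letter l)"

definition pile :: "nat letter \<Rightarrow> (nat \<Rightarrow> nat letter list) \<Rightarrow> nat \<Rightarrow> nat letter list" where
  "pile l s = (\<lambda>c. if c \<in> {fst l, Suc (fst l)} then (if pops l s then tl (s c) else l # s c) else s c)"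

text \<open>Exactly the disjointness of the column sets \<open>{x, Suc x}\<close> and
  \<open>{y, Suc y}\<close>.\<close>

definition far :: "nat \<Rightarrow> nat \<Rightarrow> bool" where
  "far x y \<longleftrightarrow> x \<noteq> y \<and> x \<noteq> Suc y \<and> y \<noteq> Suc x"

lemma pops_pile_far: "far (fst l) (fst k) \<Longrightarrow> pops l (pile k s) = pops l s"
  by (auto simp: pops_def pile_def far_def)

lemma pile_pile_far: "far (fst l) (fst k) \<Longrightarrow> c \<in> {fst l, Suc (fst l)} \<Longrightarrow>
    pile l (pile k s) c = pile l s c"
  by (simp only: pile_def[of l] pops_pile_far) (auto simp: pile_def far_def)

lemma pile_commute:
  assumes "far (fst l) (fst k)"
  shows "pile l (pile k s) = pile k (pile l s)"
proof -
  have "far (fst k) (fst l)"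
    using assms by (auto simp: far_def)
  then show ?thesis
    using assms
    by (intro ext, simp only: pile_def[of _ "pile _ _"] pops_pile_far)
      (auto simp: pile_def far_def)
qed

text \<open>The stacks reachable by pushes alone. On arbitrary stacks a letter and its inverse need
  not undo each other: a pop may uncover a letter that the inverse then pops as well.\<close>

inductive piling :: "(nat \<Rightarrow> nat letter list) \<Rightarrow> bool" where
  empty: "piling (\<lambda>_. [])"
| push: "piling s \<Longrightarrow> \<not> pops l s \<Longrightarrow> piling (pile l s)"

lemma pile_inv_push:
  assumes "\<not> pops l s"
  shows "pile (inv_letter l) (pile l s) = s"
  using assms by (auto simp: pile_def pops_def fun_eq_iff)

text \<open>The letter popped by \<open>l\<close> may be taken to be the one pushed last: a last
  push \<open>k\<close> sharing a column with \<open>l\<close> must be \<open>inv_letter l\<close>,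
  and any other \<open>k\<close> commutes past it.\<close>

lemma piling_pop:
  assumes "piling s" "pops l s"
  shows "\<exists>s'. piling s' \<and> \<not> pops (inv_letter l) s' \<and> s = pile (inv_letter l) s'"
  using assms
proof (induction rule: piling.induct)
  case empty
  then show ?case by (simp add: pops_def)
next
  case (push s k)
  have top: "hd (pile k s c) = k" if "c \<in> {fst k, Suc (fst k)}" for c
    using that push.hyps by (auto simp: pile_def)
  have top': "hd (pile k s c) = inv_letter l" if "c \<in> {fst l, Suc (fst l)}" for c
    using that push.prems by (auto simp: pops_def)
  show ?case
  proof (cases "far (fst l) (fst k)")
    case False
    then obtain c where "c \<in> {fst k, Suc (fst k)}" "c \<in> {fst l, Suc (fst l)}"
      unfolding far_def by blast
    then have "k = inv_letter l"
      using top top' by metis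
    with push.hyps show ?thesis by blast
  next
    case True
    then have far: "far (fst k) (fst (inv_letter l))" "far (fst (inv_letter l)) (fst k)"
      by (auto simp: far_def)
    obtain s' where s': "piling s'" "\<not> pops (inv_letter l) s'" "s = pile (inv_letter l) s'"
      using push.IH push.prems pops_pile_far[OF True] by auto
    have "\<not> pops k s'"
      using push.hyps s'(3) pops_pile_far[OF far(1)] by simp
    with s' have "piling (pile k s')" "\<not> pops (inv_letter l) (pile k s')"
      "pile k s = pile (inv_letter l) (pile k s')"
      by (auto intro: piling.push simp: pops_pile_far[OF far(2)] pile_commute[OF far(1)])
    then show ?thesis by blast
  qed
qed

lemma pile_inv_letter:
  assumes "piling s"
  shows "pile (inv_letter l) (pile l s) = s"
proof (cases "pops l s")
  case True
  then obtain s' where "\<not> pops (inv_letter l) s'" "s = pile (inv_letter l) s'"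
    using piling_pop[OF assms] by blast
  then show ?thesis
    using pile_inv_push[of "inv_letter l" s'] by simp
next
  case False
  then show ?thesis by (rule pile_inv_push)
qed

lemma piling_pile:
  assumes "piling s"
  shows "piling (pile l s)"
proof (cases "pops l s")
  case True
  then obtain s' where "piling s'" "\<not> pops (inv_letter l) s'" "s = pile (inv_letter l) s'"
    using piling_pop[OF assms] by blast
  then show ?thesis
    using pile_inv_push[of "inv_letter l" s'] by simp
qed (use assms in \<open>rule piling.push\<close>)

lemma piling_fold: "piling s \<Longrightarrow> piling (fold pile w s)"
  by (induction w arbitrary: s) (auto intro: piling_pile)

lemma fold_pile_pres_step:
  assumes "pres_step {..<n} (path_adj n) x y" "piling s"
  shows "fold pile x s = fold pile y s"
  using assms(1)
proof cases
  case (cancel v xs b ys)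
  then show ?thesis
    using pile_inv_letter[OF piling_fold[OF assms(2)], of "(v, b)" xs] by (simp add: inv_letter_def)
next
  case (comm u v xs a c ys)
  let ?s = "fold pile xs s"
  have "piling ?s"
    using assms(2) by (rule piling_fold)
  have "pile (v, c) (pile (u, a) ?s) = pile (u, a) (pile (v, c) ?s)"
  \<comment> \<open>A vertex is not adjacent to itself, so \<open>comm\<close> also allows
    \<open>u = v\<close>; the letters are then equal or mutually inverse.\<close>
  proof (cases "u = v")
    case True
    show ?thesis
    proof (cases "a = c")
      case False
      then have "(v, c) = inv_letter (u, a)" "(u, a) = inv_letter (v, c)"
        using True by (auto simp: inv_letter_def)
      then show ?thesis
        using pile_inv_letter[OF \<open>piling ?s\<close>] by metis
    qed (use True in simp)
  next
    case False
    then show ?thesis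
      using comm by (intro pile_commute) (auto simp: far_def path_adj_def)
  qed
  with comm show ?thesis by simp
qed

lemma fold_pile_word_eq:
  assumes "word_eq {..<n} (path_adj n) x y"
  shows "fold pile x (\<lambda>_. []) = fold pile y (\<lambda>_. [])"
  using assms by (rule word_eq_invariant) (auto intro: fold_pile_pres_step piling.empty)

lemma fold_pile_untouched:
  assumes "\<forall>x \<in> set xs. c \<notin> {x, Suc x}"
  shows "fold pile (map (\<lambda>x. (x, b)) xs) s c = s c"
  using assms by (induction xs arbitrary: s) (auto simp: pile_def)

text \<open>Pairwise \<open>far\<close> letters act on disjoint columns, so the other letters affect
  neither column \<open>c\<close> nor whether \<open>(x, b)\<close> pops.\<close>

lemma fold_pile_far:
  assumes "\<forall>x \<in> set xs. \<forall>y \<in> set xs. x \<noteq> y \<longrightarrow> far x y" "distinct xs"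
    and "x \<in> set xs" "c \<in> {x, Suc x}"
  shows "fold pile (map (\<lambda>x. (x, b)) xs) s c = pile (x, b) s c"
  using assms
proof (induction xs arbitrary: s)
  case (Cons y ys)
  show ?case
  proof (cases "x = y")
    case True
    have "\<forall>z \<in> set ys. c \<notin> {z, Suc z}"
    proof
      fix z assume "z \<in> set ys"
      then have "far x z"
        using Cons.prems True by auto
      then show "c \<notin> {z, Suc z}"
        using Cons.prems(4) by (auto simp: far_def)
    qed
    then show ?thesis
      using True by (simp add: fold_pile_untouched)
  next
    case False
    then have "x \<in> set ys" and "far x y"
      using Cons.prems by auto
    then show ?thesis
      using Cons.IH[of "pile (y, b) s"] Cons.prems pile_pile_far[of "(x, b)" "(y, b)" c s] by simp
  qed
qed simp

section \<open>Injectivity\<close>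

definition run :: "nat \<Rightarrow> nat \<Rightarrow> nat letter list \<Rightarrow> (nat \<Rightarrow> nat letter list) \<Rightarrow> nat \<Rightarrow> nat letter list" where
  "run m n w s = fold pile (pb_word {..<n} (\<lambda>j. j mod m) w) s"

lemma run_simps [simp]:
  "run m n [] s = s"
  "run m n (x @ y) s = run m n y (run m n x s)"
  by (simp_all add: run_def)

text \<open>Consecutive numbers have different residues, so the lifts of one letter are pairwise
  \<open>far\<close> and column \<open>c\<close> sees only the lift \<open>x\<close>.\<close>

lemma run_letter_touched:
  assumes "2 \<le> m" "x < n" "x mod m = fst l" "c \<in> {x, Suc x}"
  shows "run m n [l] s c = pile (x, snd l) s c"
proof -
  obtain xs where xs: "pb_letter {..<n} (\<lambda>j. j mod m) l = map (\<lambda>x. (x, snd l)) xs" "distinct xs"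
    "set xs = {x \<in> {..<n}. x mod m = fst l}"
    by (rule pb_letter_eq_map[of "{..<n}" "\<lambda>j. j mod m" l]) auto
  have "far y z" if "y \<noteq> z" "y mod m = z mod m" for y z
  proof -
    have "Suc k mod m \<noteq> k mod m" for k
      using assms(1) by (auto simp: mod_Suc)
    then show ?thesis
      using that unfolding far_def by metis
  qed
  then show ?thesis
    using fold_pile_far[of xs x c "snd l" s] xs assms by (simp add: run_def)
qed

lemma run_letter_untouched:
  assumes "\<And>x. x < n \<Longrightarrow> x mod m = fst l \<Longrightarrow> c \<notin> {x, Suc x}"
  shows "run m n [l] s c = s c"
proof -
  obtain xs where "pb_letter {..<n} (\<lambda>j. j mod m) l = map (\<lambda>x. (x, snd l)) xs"
    "set xs = {x \<in> {..<n}. x mod m = fst l}"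
    by (rule pb_letter_eq_map[of "{..<n}" "\<lambda>j. j mod m" l]) auto
  then show ?thesis
    using assms fold_pile_untouched[of xs c "snd l" s] by (simp add: run_def)
qed

text \<open>A lift of the cycle, cut open at one edge, to \<open>m\<close> consecutive vertices \<open>x 0, x 1, \<dots>\<close> of
  the path, read in either direction; \<open>E j\<close> is the column between \<open>x (j - 1)\<close> and \<open>x j\<close>.\<close>

locale lifted_arc =
  fixes m n :: nat and x E :: "nat \<Rightarrow> nat"
  assumes m: "2 \<le> m"
    and x_less: "j < m \<Longrightarrow> x j < n"
    and columns: "j < m \<Longrightarrow> {x j, Suc (x j)} = {E j, E (Suc j)}"
    and inj: "inj_on (\<lambda>j. x j mod m) {..<m}"
    and not_adj: "Suc i < j \<Longrightarrow> Suc j < m \<Longrightarrow> \<not> cycle_adj m (x j mod m) (x i mod m)"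
begin

definition lab :: "nat \<Rightarrow> nat" where
  "lab j = x j mod m"

lemma lab_eq_iff: "i < m \<Longrightarrow> j < m \<Longrightarrow> lab i = lab j \<longleftrightarrow> i = j"
  using inj_on_eq_iff[OF inj, of i j] by (simp add: lab_def)

lemma run_lab:
  assumes "j < m" "c \<in> {E j, E (Suc j)}"
  shows "run m n [(lab j, b)] s c = (if pops (x j, b) s then tl (s c) else (x j, b) # s c)"
proof -
  have c: "c \<in> {x j, Suc (x j)}"
    using assms columns by blast
  then have "run m n [(lab j, b)] s c = pile (x j, b) s c"
    using run_letter_touched[of m "x j" n "(lab j, b)" c s] m x_less[OF assms(1)]
    by (simp add: lab_def)
  with c show ?thesis
    by (simp add: pile_def)
qed

lemma pops_lab:
  assumes "j < m" "pops (x j, b) s" "c \<in> {E j, E (Suc j)}"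
  shows "s c \<noteq> []" "hd (s c) = (x j, \<not> b)"
proof -
  have "c \<in> {x j, Suc (x j)}"
    using assms columns by blast
  then show "s c \<noteq> []" "hd (s c) = (x j, \<not> b)"
    using assms(2) by (auto simp: pops_def inv_letter_def)
qed

text \<open>Only \<open>x j\<close> and \<open>x (Suc j)\<close> touch this column, and neither lies
  over \<open>lab i\<close>; this covers all lifts of \<open>lab i\<close>, also those outside the
  arc.\<close>

lemma run_other:
  assumes "i < j" "Suc j < m"
  shows "run m n [(lab i, b)] s (E (Suc j)) = s (E (Suc j))"
proof (rule run_letter_untouched)
  fix z
  assume z: "z < n" "z mod m = fst (lab i, b)"
  have "lab i \<noteq> lab j" "lab i \<noteq> lab (Suc j)" "lab j \<noteq> lab (Suc j)"
    using assms lab_eq_iff by auto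
  then have "z \<noteq> x j" "z \<noteq> x (Suc j)" "x j \<noteq> x (Suc j)"
    using z by (auto simp: lab_def)
  moreover have "{x j, Suc (x j)} = {E j, E (Suc j)}"
    "{x (Suc j), Suc (x (Suc j))} = {E (Suc j), E (Suc (Suc j))}"
    using assms columns by auto
  ultimately show "E (Suc j) \<notin> {z, Suc z}"
    by (auto simp: doubleton_eq_iff)
qed

text \<open>Between two letters \<open>lab j\<close> that cancel in the lift, the column \<open>E j\<close> returns to its previous
  height; by induction nothing cancels in this column meanwhile, so no letter \<open>lab (j - 1)\<close> occurs in
  between, and the two letters already cancel in the cycle.\<close>

lemma run_reduced:
  assumes "Suc j < m" "reduced (cycle_adj m) w" "fst ` set w \<subseteq> lab ` {..j}"
    and "s (E (Suc j)) = [] \<or> fst (hd (s (E (Suc j)))) \<noteq> x j"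
  shows "run m n w s (E (Suc j)) =
    rev (map (\<lambda>l. (x j, snd l)) (filter (\<lambda>l. fst l = lab j) w)) @ s (E (Suc j))"
  using assms
proof (induction j arbitrary: w s rule: less_induct)
  case (less j)
  \<comment> \<open>The outer induction, on \<open>j\<close>, allows any starting stacks; it will be
    applied to a middle factor of the word. The inner one, on the length of \<open>w\<close>, keeps
    \<open>s\<close> fixed and is applied to prefixes.\<close>
  note outer = less.IH and j = less.prems(1) and top = less.prems(4)
  from less.prems(2,3) show ?case
  proof (induction w rule: length_induct)
    case (1 w)
    note inner = "1.IH"[rule_format] and red = "1.prems"(1) and supp = "1.prems"(2)
    show ?case
    proof (cases w rule: rev_cases)
      case (snoc u l)
      define t where "t = run m n u s"
      have red_u: "reduced (cycle_adj m) u" and supp_u: "fst ` set u \<subseteq> lab ` {..j}"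
        using reduced_prefix[of _ u "[l]"] red supp snoc by auto
      have t: "t (E (Suc j)) =
          rev (map (\<lambda>l. (x j, snd l)) (filter (\<lambda>l. fst l = lab j) u)) @ s (E (Suc j))"
        unfolding t_def by (rule inner) (use red_u supp_u snoc in auto)
      obtain i where i: "fst l = lab i" "i \<le> j"
        using supp snoc by auto
      have run_w: "run m n w s = run m n [(lab i, snd l)] t"
        using snoc by (simp add: t_def flip: i(1))
      show ?thesis
      proof (cases "i = j")
        case False
        then have "lab i \<noteq> lab j"
          using i j lab_eq_iff by auto
        then show ?thesis
          unfolding run_w using run_other[of i j "snd l" t] i j False t snoc by simp
      next
        case True
        have "\<not> pops (x j, snd l) t"
        proof
          assume pop: "pops (x j, snd l) t"
          note top_t = pops_lab[OF Suc_lessD[OF j] pop]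
          \<comment> \<open>Otherwise the column would still be that of \<open>s\<close>, which has
            no letter at \<open>x j\<close> on top to be popped.\<close>
          have "\<exists>k \<in> set u. fst k = lab j"
          proof (rule ccontr)
            assume "\<not> (\<exists>k \<in> set u. fst k = lab j)"
            then have "t (E (Suc j)) = s (E (Suc j))"
              using t by (simp add: filter_empty_conv)
            then show False
              using top top_t[of "E (Suc j)"] by auto
          qed
          then obtain p k y where u: "u = p @ k # y" "fst k = lab j" "\<forall>k' \<in> set y. fst k' \<noteq> lab j"
            using split_list_last_prop[of u "\<lambda>k. fst k = lab j"] by blast
          have no_y: "filter (\<lambda>l. fst l = lab j) y = []"
            using u(3) by (simp add: filter_empty_conv)
          have "hd (t (E (Suc j))) = (x j, snd k)"
            using t u no_y by simp
          then have l: "l = inv_letter k"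
            using top_t[of "E (Suc j)"] u(2) i True by (auto simp: inv_letter_def prod_eq_iff)
          define t0 where "t0 = run m n p s"
          define t1 where "t1 = run m n (p @ [k]) s"
          have t01: "t1 = run m n [k] t0"
            by (simp add: t0_def t1_def)
          have "t0 (E (Suc j)) =
              rev (map (\<lambda>l. (x j, snd l)) (filter (\<lambda>l. fst l = lab j) p)) @ s (E (Suc j))"
            unfolding t0_def
            by (rule inner) (use red_u supp_u snoc u in \<open>auto dest: reduced_prefix\<close>)
          moreover have "t1 (E (Suc j)) =
              rev (map (\<lambda>l. (x j, snd l)) (filter (\<lambda>l. fst l = lab j) (p @ [k]))) @ s (E (Suc j))"
            unfolding t1_def
            by (rule inner)
              (use red_u supp_u snoc u reduced_prefix[of _ "p @ [k]" y] in auto)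
          ultimately have t1_Suc: "t1 (E (Suc j)) = (x j, snd k) # t0 (E (Suc j))"
            using u(2) by simp
          have k: "k = (lab j, snd k)"
            using u(2) by (simp add: prod_eq_iff)
          have t1_eq: "t1 c = (if pops (x j, snd k) t0 then tl (t0 c) else (x j, snd k) # t0 c)"
            if "c \<in> {E j, E (Suc j)}" for c
            using run_lab[OF Suc_lessD[OF j] that, of "snd k" t0] unfolding t01 k[symmetric] .
          \<comment> \<open>Column \<open>E (Suc j)\<close> grew when \<open>k\<close> was read. A
            letter pops on both of its columns or pushes on both, so \<open>k\<close> was also
            pushed on \<open>E j\<close>.\<close>
          have "length (t1 (E (Suc j))) \<noteq> length (tl (t0 (E (Suc j))))"
            using t1_Suc by simp
          then have "\<not> pops (x j, snd k) t0"
            using t1_eq[of "E (Suc j)"] by auto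
          then have t1: "t1 (E j) = (x j, snd k) # t0 (E j)"
            using t1_eq[of "E j"] by simp
          have ty: "t = run m n y t1"
            by (simp add: t_def t1_def u(1) flip: run_simps(2))
          have red_y: "reduced (cycle_adj m) y"
            using reduced_suffix[of _ "p @ [k]" y] red_u u(1) by simp
          have supp_y: "\<exists>i < j. fst k' = lab i" if "k' \<in> set y" for k'
          proof -
            have "fst k' \<in> fst ` set u"
              using that u(1) by simp
            then obtain i where "i \<le> j" "fst k' = lab i"
              using supp_u by blast
            moreover from this have "i \<noteq> j"
              using u(3) that by auto
            ultimately show ?thesis
              using le_neq_implies_less by blast
          qed
          have "commuting (cycle_adj m) [k] y"
          proof (cases j)
            case 0
            then have "y = []"
              using supp_y by (cases y) auto
            then show ?thesis
              by (simp add: commuting_def)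
          next
            \<comment> \<open>After \<open>k\<close> the top of column \<open>E j\<close> is at
              \<open>x j\<close>, so the outer hypothesis applies to \<open>y\<close>: letters
              \<open>lab h\<close> would stay on top there, but the pop by \<open>l\<close> needs a
              letter at \<open>x j\<close>.\<close>
            case (Suc h)
            have "lab j \<noteq> lab h"
              using Suc j lab_eq_iff by auto
            then have "x j \<noteq> x h"
              by (auto simp: lab_def)
            moreover have "fst ` set y \<subseteq> lab ` {..h}"
              using supp_y Suc by fastforce
            ultimately have "t (E j) =
                rev (map (\<lambda>l. (x h, snd l)) (filter (\<lambda>l. fst l = lab h) y)) @ t1 (E j)"
              unfolding ty Suc
              by (intro outer) (use Suc j red_y t1 in auto)
            then have no_h: "filter (\<lambda>l. fst l = lab h) y = []"
              using top_t(2)[of "E j"] \<open>x j \<noteq> x h\<close>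
              by (cases "filter (\<lambda>l. fst l = lab h) y" rule: rev_cases) auto
            then have "\<exists>i. Suc i < j \<and> fst k' = lab i" if k': "k' \<in> set y" for k'
            proof -
              obtain i where "i < j" "fst k' = lab i"
                using supp_y[OF k'] by blast
              moreover have "fst k' \<noteq> lab h"
                using no_h k' by (simp add: filter_empty_conv)
              ultimately show ?thesis
                using Suc by (intro exI[of _ i], cases "i = h") auto
            qed
            \<comment> \<open>What is left of \<open>y\<close> lies at arc positions below
              \<open>j - 1\<close>. Since \<open>Suc j < m\<close>, the end of the arc, where the
              cycle closes up, is not involved.\<close>
            then show ?thesis
              using not_adj j u(2) by (fastforce simp: commuting_def lab_def)
          qed
          moreover have "w = p @ k # y @ inv_letter k # []"
            using snoc u(1) l by simp
          ultimately show False
            using red unfolding reduced_def by blast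
        qed
        then show ?thesis
          unfolding run_w using run_lab[of j "E (Suc j)" "snd l" t] j t i True snoc by simp
      qed
    qed simp
  qed
qed

text \<open>The case \<open>j = m - 2\<close>. Distinct labels exhaust the cycle, so avoiding the
  last one confines \<open>w\<close> to the arc; \<open>x (m - 2) < m\<close> makes this vertex its
  own label.\<close>

lemma run_reduced_last:
  assumes "reduced (cycle_adj m) w" "w \<in> words {..<m}" "\<forall>l \<in> set w. fst l \<noteq> lab (m - 1)"
    and "x (m - 2) < m" and "s (E (m - 1)) = [] \<or> fst (hd (s (E (m - 1)))) \<noteq> x (m - 2)"
  shows "run m n w s (E (m - 1)) = rev (filter (\<lambda>l. fst l = x (m - 2)) w) @ s (E (m - 1))"
proof -
  have Suc: "Suc (m - 2) = m - 1" and lab: "lab (m - 2) = x (m - 2)"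
    using m assms(4) by (simp_all add: lab_def)
  have "lab ` {..<m} = {..<m}"
  proof (rule endo_inj_surj)
    show "lab ` {..<m} \<subseteq> {..<m}"
      using m by (auto simp: lab_def)
    show "inj_on lab {..<m}"
      unfolding lab_def by (rule inj)
  qed simp
  moreover have "{..<m} = insert (m - 1) {..m - 2}"
    using m by auto
  ultimately have "{..<m} \<subseteq> insert (lab (m - 1)) (lab ` {..m - 2})"
    by (metis image_insert order_refl)
  then have "fst ` set w \<subseteq> lab ` {..m - 2}"
    using assms(2,3) by (auto simp: words_iff)
  then have "run m n w s (E (m - 1)) =
      rev (map (\<lambda>l. (x (m - 2), snd l)) (filter (\<lambda>l. fst l = x (m - 2)) w)) @ s (E (m - 1))"
    using run_reduced[of "m - 2" w s] assms m by (simp add: Suc lab)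
  moreover have "map (\<lambda>l. (x (m - 2), snd l)) (filter (\<lambda>l. fst l = x (m - 2)) w) =
      filter (\<lambda>l. fst l = x (m - 2)) w"
    by (rule map_idI) auto
  ultimately show ?thesis by simp
qed

end

section \<open>The two arcs and the column between them\<close>

lemma lifted_arc_forward:
  assumes "3 \<le> m" "2 * m - 2 \<le> n"
  shows "lifted_arc m n (\<lambda>j. j) (\<lambda>j. j)"
proof
  show "\<not> cycle_adj m (j mod m) (i mod m)" if "Suc i < j" "Suc j < m" for i j
    using that by (simp add: cycle_adj_def)
qed (use assms in \<open>auto simp: inj_on_def\<close>)

text \<open>The arc descends from \<open>2 * m - 3\<close> to \<open>m - 2\<close>, with labels
  \<open>m - 3, ..., 0, m - 1, m - 2\<close>. Its column \<open>E (m - 1)\<close> is column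
  \<open>m - 1\<close>, as for the forward arc.\<close>

lemma lifted_arc_backward:
  assumes "3 \<le> m" "2 * m - 2 \<le> n"
  shows "lifted_arc m n (\<lambda>j. 2 * m - 3 - j) (\<lambda>j. 2 * m - 2 - j)"
proof
  have lab: "(2 * m - 3 - j) mod m = (if Suc (Suc j) < m then m - 3 - j else 2 * m - 3 - j)"
    if "j < m" for j
  proof (cases "Suc (Suc j) < m")
    case True
    then have "2 * m - 3 - j = m + (m - 3 - j)"
      by auto
    then have "(2 * m - 3 - j) mod m = (m - 3 - j) mod m"
      by (metis mod_add_self1)
    with True show ?thesis by simp
  qed (use that assms in auto)
  show "inj_on (\<lambda>j. (2 * m - 3 - j) mod m) {..<m}"
  proof (rule inj_onI)
    fix i j
    assume "i \<in> {..<m}" "j \<in> {..<m}" "(2 * m - 3 - i) mod m = (2 * m - 3 - j) mod m"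
    then show "i = j"
      using lab[of i] lab[of j] assms by (simp split: if_splits)
  qed
  show "\<not> cycle_adj m ((2 * m - 3 - j) mod m) ((2 * m - 3 - i) mod m)"
    if "Suc i < j" "Suc j < m" for i j
  proof -
    have "(2 * m - 3 - i) mod m = m - 3 - i"
      using lab[of i] that by simp
    moreover have "(2 * m - 3 - j) mod m = (if Suc (Suc j) < m then m - 3 - j else m - 1)"
      using lab[of j] that by auto
    ultimately show ?thesis
      using that assms by (auto simp only: cycle_adj_def) (auto simp: mod_Suc split: if_splits)
  qed
  show "{2 * m - 3 - j, Suc (2 * m - 3 - j)} = {2 * m - 2 - j, 2 * m - 2 - Suc j}" if "j < m" for j
    using that assms by (auto simp: doubleton_eq_iff)
qed (use assms in auto)

text \<open>No cancellation at all takes place in the column between the vertices \<open>m - 2\<close> and \<open>m - 1\<close>: after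
  a letter \<open>m - 1\<close> the forward arc protects the letters \<open>m - 2\<close>, and conversely for the backward
  arc.  Both arcs fit into the path exactly because it has at least \<open>2 * m - 2\<close> vertices.\<close>

lemma run_reduced_middle:
  assumes m: "3 \<le> m" and n: "2 * m - 2 \<le> n"
    and "reduced (cycle_adj m) w" "w \<in> words {..<m}"
  shows "run m n w (\<lambda>_. []) (m - 1) = rev (filter (\<lambda>l. m - 2 \<le> fst l) w)"
  using assms(3,4)
proof (induction w rule: length_induct)
  case (1 w)
  let ?run = "\<lambda>w. run m n w (\<lambda>_. [])"
  note IH = "1.IH"[rule_format] and red = "1.prems"(1) and words = "1.prems"(2)
  have ends: "m - 2 \<le> fst l \<longleftrightarrow> fst l = m - 2 \<or> fst l = m - 1" if "l \<in> set w" for l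
    using words that by (auto simp: words_iff)
  \<comment> \<open>Here \<open>b\<close> is the last label of the arc and \<open>a\<close> the
    vertex it protects. The word is cut after its last letter at \<open>b\<close>; by induction this
    letter tops the column, so \<open>arc\<close> applies to the rest.\<close>
  have step: ?case
    if ab: "a = m - 2 \<and> b = m - 1 \<or> a = m - 1 \<and> b = m - 2"
      and last: "w = [] \<or> fst (last w) \<noteq> b"
      and arc: "\<And>y s. reduced (cycle_adj m) y \<Longrightarrow> y \<in> words {..<m} \<Longrightarrow>
        \<forall>l \<in> set y. fst l \<noteq> b \<Longrightarrow> s (m - 1) = [] \<or> fst (hd (s (m - 1))) \<noteq> a \<Longrightarrow>
        run m n y s (m - 1) = rev (filter (\<lambda>l. fst l = a) y) @ s (m - 1)"
    for a b
  proof (cases "\<exists>k \<in> set w. fst k = b")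
    case False
    then have "filter (\<lambda>l. m - 2 \<le> fst l) w = filter (\<lambda>l. fst l = a) w"
      using ab ends by (intro filter_cong) auto
    then show ?thesis
      using arc[of w "\<lambda>_. []"] red words False by auto
  next
    case True
    then obtain p k y where w: "w = p @ k # y" "fst k = b" "\<forall>l \<in> set y. fst l \<noteq> b"
      using split_list_last_prop[of w "\<lambda>k. fst k = b"] by blast
    \<comment> \<open>This makes \<open>p @ [k]\<close> strictly shorter than \<open>w\<close>, as
      the induction requires.\<close>
    have "y \<noteq> []"
      using last w by auto
    have "reduced (cycle_adj m) (p @ [k])" "reduced (cycle_adj m) y"
      using red w(1) reduced_prefix[of _ "p @ [k]" y] reduced_suffix[of _ "p @ [k]" y] by simp_all
    moreover have "p @ [k] \<in> words {..<m}" "y \<in> words {..<m}"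
      using words w(1) by simp_all
    moreover have "filter (\<lambda>l. m - 2 \<le> fst l) y = filter (\<lambda>l. fst l = a) y"
      using ab ends w by (intro filter_cong) auto
    moreover have "m - 2 \<le> b" "a \<noteq> b"
      using ab m by auto
    moreover have "?run (p @ [k]) (m - 1) = rev (filter (\<lambda>l. m - 2 \<le> fst l) (p @ [k]))"
      using IH[of "p @ [k]"] calculation w(1) \<open>y \<noteq> []\<close> by simp
    moreover have "?run w = run m n y (?run (p @ [k]))"
      using w(1) by (simp flip: run_simps(2))
    ultimately show ?thesis
      using arc[of y "?run (p @ [k])"] w by simp
  qed
  show ?case
  \<comment> \<open>The final letter selects the arc: its vertex must differ from the last label of
    the arc.\<close>
  proof (cases "w = [] \<or> fst (last w) \<noteq> m - 1")
    case True
    interpret lifted_arc m n "\<lambda>j. j" "\<lambda>j. j"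
      using m n by (rule lifted_arc_forward)
    show ?thesis
      by (rule step[of "m - 2" "m - 1"]) (use True m run_reduced_last in \<open>auto simp: lab_def\<close>)
  next
    case False
    interpret lifted_arc m n "\<lambda>j. 2 * m - 3 - j" "\<lambda>j. 2 * m - 2 - j"
      using m n by (rule lifted_arc_backward)
    have "2 * m - 3 - (m - 1) = m - 2"
      using m by simp
    then have eqs: "lab (m - 1) = m - 2" "2 * m - 3 - (m - 2) = m - 1" "2 * m - 2 - (m - 1) = m - 1"
      unfolding lab_def using m by simp_all
    show ?thesis
      by (rule step[of "m - 1" "m - 2"]) (use False m run_reduced_last[unfolded eqs] in auto)
  qed
qed

text \<open>The empty middle column excludes \<open>m - 2\<close> and \<open>m - 1\<close>. Then,
  for the largest remaining vertex \<open>k\<close>, the forward arc would record every letter at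
  \<open>k\<close> in column \<open>Suc k\<close>, which is empty too.\<close>

lemma reduced_kernel_trivial:
  assumes m: "3 \<le> m" and n: "2 * m - 2 \<le> n"
    and red: "reduced (cycle_adj m) w" and words: "w \<in> words {..<m}"
    and ker: "word_eq {..<n} (path_adj n) (pb_word {..<n} (\<lambda>j. j mod m) w) []"
  shows "w = []"
proof (rule ccontr)
  assume "w \<noteq> []"
  have run: "run m n w (\<lambda>_. []) = (\<lambda>_. [])"
    using fold_pile_word_eq[OF ker] by (simp add: run_def)
  then have small: "fst l < m - 2" if "l \<in> set w" for l
    using run_reduced_middle[OF m n red words] that by (auto simp: filter_empty_conv not_le)
  define k where "k = Max (fst ` set w)"
  have "k \<in> fst ` set w"
    using \<open>w \<noteq> []\<close> by (simp add: k_def)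
  then have k: "k < m - 2"
    using small by auto
  interpret lifted_arc m n "\<lambda>j. j" "\<lambda>j. j"
    using m n by (rule lifted_arc_forward)
  have lab: "lab j = j" if "j \<le> k" for j
    using that k by (simp add: lab_def)
  have "fst ` set w \<subseteq> lab ` {..k}"
  proof
    fix v
    assume "v \<in> fst ` set w"
    then have "v \<le> k"
      by (simp add: k_def)
    with lab[of v] show "v \<in> lab ` {..k}"
      by force
  qed
  then have "filter (\<lambda>l. fst l = k) w = []"
    using run_reduced[of k w "\<lambda>_. []"] k red run lab by simp
  with \<open>k \<in> fst ` set w\<close> show False
    by (auto simp: filter_empty_conv)
qed

lemma kernel_trivial:
  assumes "3 \<le> m" "2 * m - 2 \<le> n" "w \<in> words {..<m}"
    and "word_eq {..<n} (path_adj n) (pb_word {..<n} (\<lambda>j. j mod m) w) []"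
  shows "word_eq {..<m} (cycle_adj m) w []"
proof -
  interpret graph_map "{..<m}" "cycle_adj m" "{..<n}" "path_adj n" "\<lambda>j. j mod m"
    using assms by (intro graph_map_path_cycle) simp
  obtain w' where w': "word_eq {..<m} (cycle_adj m) w w'" "reduced (cycle_adj m) w'"
    using exists_reduced assms(3) by blast
  have "word_eq {..<n} (path_adj n) (pb_word {..<n} (\<lambda>j. j mod m) w') []"
    using word_eq_pb_word[OF w'(1)] assms(4) by (metis word_eq_sym word_eq_trans)
  moreover have "w' \<in> words {..<m}"
    using word_eq_words[OF w'(1)] assms(3) by simp
  ultimately have "w' = []"
    using reduced_kernel_trivial assms w'(2) by blast
  with w'(1) show ?thesis by simp
qed

section \<open>A kernel element for short paths\<close>

lemma word_eq_commutator:
  assumes "x \<in> words V" "y \<in> words V"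
  shows "word_eq V adj (x @ y @ inv_word x @ inv_word y) [] \<longleftrightarrow> word_eq V adj (x @ y) (y @ x)"
  using word_eq_iff_quotient[of "y @ x" V adj "x @ y"] assms by simp

lemma word_eq_partition:
  assumes "w \<in> words V" "commuting adj (filter (\<lambda>l. \<not> P l) w) (filter P w)"
  shows "word_eq V adj w (filter P w @ filter (\<lambda>l. \<not> P l) w)"
  using assms
proof (induction w)
  case (Cons l w)
  let ?p = "filter P w" and ?q = "filter (\<lambda>l. \<not> P l) w"
  have "word_eq V adj w (?p @ ?q)"
  proof (rule Cons.IH)
    show "commuting adj ?q ?p"
      by (rule commuting_mono[OF Cons.prems(2)]) auto
  qed (use Cons.prems in simp)
  then have eq: "word_eq V adj (l # w) (l # ?p @ ?q)"
    using word_eq_context[of V adj w "?p @ ?q" "[l]" "[]"] by simp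
  show ?case
  proof (cases "P l")
    case False
    have "word_eq V adj (l # ?p) (?p @ [l])"
      using Cons.prems False by (intro word_eq_commute_letter) (auto simp: commuting_def words_iff)
    then have "word_eq V adj ((l # ?p) @ ?q) ((?p @ [l]) @ ?q)"
      by (intro word_eq_append) auto
    with eq False show ?thesis
      by (auto intro: word_eq_trans)
  qed (use eq in simp)
qed simp

text \<open>Letters commuting with both \<open>f\<close> and the rest of the conjugator move next to
  their inverses and cancel. This will remove the second lift of the staircase.\<close>

lemma word_eq_conjugate_partition:
  assumes "w \<in> words V" "f \<in> words V" "commuting adj (filter (\<lambda>l. \<not> P l) w) (filter P w @ f)"
  shows "word_eq V adj (w @ f @ inv_word w) (filter P w @ f @ inv_word (filter P w))"
proof -
  let ?p = "filter P w" and ?q = "filter (\<lambda>l. \<not> P l) w"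
  have words: "?p \<in> words V" "?q \<in> words V"
    using assms(1) by (auto simp: words_iff)
  have split: "word_eq V adj w (?p @ ?q)"
    using commuting_mono[OF assms(3)] by (intro word_eq_partition assms(1)) simp
  have inv: "word_eq V adj (inv_word w) (inv_word (?p @ ?q))"
  proof -
    have "word_eq V adj (inv_word w @ w) (inv_word w @ ?p @ ?q)"
      using split by (intro word_eq_append) auto
    with word_eq_inverse_left[OF assms(1), of adj]
    have "word_eq V adj (inv_word w @ inv_word (inv_word (?p @ ?q))) []"
      by (metis inv_word_simps(4) word_eq_sym word_eq_trans)
    then show ?thesis
      using words by (subst word_eq_iff_quotient) auto
  qed
  have "word_eq V adj (w @ f @ inv_word w) ((?p @ ?q) @ f @ inv_word (?p @ ?q))"
    using split inv by (intro word_eq_append) auto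
  also have "word_eq V adj (?p @ (?q @ f) @ (inv_word ?q @ inv_word ?p))
      (?p @ (f @ ?q) @ (inv_word ?q @ inv_word ?p))"
    using assms words by (intro word_eq_context word_eq_commute) (auto simp: commuting_def)
  then have "word_eq V adj ((?p @ ?q) @ f @ inv_word (?p @ ?q))
      ((?p @ f) @ (?q @ inv_word ?q) @ inv_word ?p)"
    by simp
  also have "word_eq V adj ((?p @ f) @ (?q @ inv_word ?q) @ inv_word ?p) ((?p @ f) @ [] @ inv_word ?p)"
    using words by (intro word_eq_context word_eq_inverse_right)
  finally show ?thesis by simp
qed

section \<open>The commutator, its lift and its nontriviality\<close>

definition staircase :: "nat \<Rightarrow> nat letter list" where
  "staircase k = map (\<lambda>i. (i, True)) [0..<k]"

definition conj_staircase :: "nat \<Rightarrow> nat letter list" where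
  "conj_staircase k = staircase k @ [(k, True)] @ inv_word (staircase k)"

lemma staircase_words: "k \<le> m \<Longrightarrow> staircase k \<in> words {..<m}"
  by (auto simp: staircase_def words_iff)

lemma conj_staircase_words: "k < m \<Longrightarrow> conj_staircase k \<in> words {..<m}"
  by (simp add: conj_staircase_def staircase_words)

text \<open>The arc \<open>0, \<dots>, m - 3\<close> lifts completely to \<open>0, \<dots>, m - 3\<close>; its only other lift lacks the last
  vertex, where the conjugate becomes trivial.  The letter \<open>m - 1\<close> lifts only to \<open>m - 1\<close>, which
  commutes with the first lift.\<close>

lemma commutator_in_kernel:
  assumes m: "3 \<le> m" and n: "n < 2 * m - 2"
  defines "pb \<equiv> pb_word {..<n} (\<lambda>j. j mod m)"
  defines "c \<equiv> conj_staircase (m - 3)" and "d \<equiv> [(m - 1, True)]"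
  shows "word_eq {..<n} (path_adj n) (pb (c @ d @ inv_word c @ inv_word d)) []"
proof -
  let ?g = "pb (staircase (m - 3))" and ?f = "pb [(m - 3, True)]"
  let ?h = "filter (\<lambda>l. fst l < m) ?g"
  have words: "pb w \<in> words {..<n}" for w
    by (simp add: pb_def)
  have g: "fst l < m - 3 \<or> m \<le> fst l \<and> fst l < n" if "l \<in> set ?g" for l
    using that by (cases "fst l < m") (auto simp: pb_def set_pb_word staircase_def)
  \<comment> \<open>The bound on \<open>n\<close> enters here: the next vertex over
    \<open>m - 3\<close> would be \<open>2 * m - 3\<close>, which is beyond the path.\<close>
  have f: "fst l = m - 3" if "l \<in> set ?f" for l
  proof -
    have l: "fst l mod m = m - 3" "fst l < n"
      using that by (auto simp: pb_def set_pb_word simp del: pb_word_simps)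
    show ?thesis
    proof (cases "fst l < m")
      case False
      then have "(fst l - m) mod m = m - 3"
        using l(1) by (simp add: le_mod_geq)
      then show ?thesis
        using False l(2) n by simp
    qed (use l in simp)
  qed
  have d: "fst l = m - 1" if "l \<in> set (pb d)" for l
  proof -
    have l: "fst l mod m = m - 1" "fst l < n"
      using that by (auto simp: pb_def d_def set_pb_word simp del: pb_word_simps)
    show ?thesis
    proof (cases "fst l < m")
      case False
      then have "(fst l - m) mod m = m - 1"
        using l(1) by (simp add: le_mod_geq)
      then show ?thesis
        using False l(2) n by simp
    qed (use l in simp)
  qed
  have g0_words: "?h \<in> words {..<n}"
    using words[of "staircase (m - 3)"] by (simp add: words_iff)
  have "pb c = ?g @ ?f @ inv_word ?g"
    by (simp add: c_def conj_staircase_def pb_def pb_word_inv_word)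
  \<comment> \<open>The second lift starts at \<open>m\<close>, while \<open>?h\<close> and
    \<open>?f\<close> stay at or below \<open>m - 3\<close>.\<close>
  moreover have "commuting (path_adj n) (filter (\<lambda>l. \<not> fst l < m) ?g) (?h @ ?f)"
    using g f m by (fastforce simp: commuting_def path_adj_def)
  ultimately have c: "word_eq {..<n} (path_adj n) (pb c) (?h @ ?f @ inv_word ?h)"
    using word_eq_conjugate_partition[OF words words] by simp
  have "\<not> path_adj n (fst l) (fst l')" if "l \<in> set (?h @ ?f @ inv_word ?h)" "l' \<in> set (pb d)" for l l'
  proof -
    have "fst k \<le> m - 3" if "k \<in> set ?h \<or> k \<in> set ?f" for k
      using that g[of k] f[of k] by auto
    moreover have "l \<in> set ?h \<or> l \<in> set ?f \<or> l \<in> inv_letter ` set ?h"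
      using that(1) unfolding set_append set_inv_word by blast
    ultimately have "fst l \<le> m - 3"
      by (elim disjE imageE) simp_all
    then show ?thesis
      using d[OF that(2)] m by (auto simp: path_adj_def)
  qed
  then have swap: "word_eq {..<n} (path_adj n) ((?h @ ?f @ inv_word ?h) @ pb d) (pb d @ (?h @ ?f @ inv_word ?h))"
    using words g0_words by (intro word_eq_commute) (auto simp: commuting_def)
  have cd: "word_eq {..<n} (path_adj n) (pb c @ pb d) ((?h @ ?f @ inv_word ?h) @ pb d)"
    and dc: "word_eq {..<n} (path_adj n) (pb d @ pb c) (pb d @ (?h @ ?f @ inv_word ?h))"
    using c by (auto intro: word_eq_append simp del: append_assoc)
  have "word_eq {..<n} (path_adj n) (pb c @ pb d) (pb d @ pb c)"
    by (rule word_eq_trans[OF word_eq_trans[OF cd swap] word_eq_sym[OF dc]])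
  then show ?thesis
    using word_eq_commutator[OF words words] by (simp add: pb_def pb_word_inv_word)
qed

text \<open>The generators other than \<open>m - 2\<close> act as the consecutive transpositions of \<open>0, \<dots>, m - 1\<close>.\<close>

definition cycle_perm :: "nat \<Rightarrow> nat \<Rightarrow> nat \<Rightarrow> nat" where
  "cycle_perm m v = (if v = m - 1 then transpose 0 1
     else if v = m - 2 then id else transpose (v + 1) (v + 2))"

text \<open>Signs may be ignored because the generators act as involutions. The last letter of the
  word acts first.\<close>

definition perm_word :: "nat \<Rightarrow> nat letter list \<Rightarrow> nat \<Rightarrow> nat" where
  "perm_word m w = foldr (\<lambda>l f. cycle_perm m (fst l) \<circ> f) w id"

lemma cycle_perm_involutory [simp]: "cycle_perm m v (cycle_perm m v i) = i"
  by (simp add: cycle_perm_def)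

lemma transpose_commute_disjoint:
  "{a, b} \<inter> {c, d} = {} \<Longrightarrow> transpose a b (transpose c d i) = transpose c d (transpose a b i)"
  by (auto simp: transpose_def)

text \<open>In the order \<open>m - 1, 0, 1, ..., m - 3\<close> only neighbouring generators have
  overlapping transpositions, and neighbours in this order are adjacent in the cycle.\<close>

lemma cycle_perm_commute:
  assumes "u < m" "v < m" "\<not> cycle_adj m u v"
  shows "cycle_perm m u (cycle_perm m v i) = cycle_perm m v (cycle_perm m u i)"
proof (cases "u = v")
  case False
  have "v \<noteq> Suc u mod m" "u \<noteq> Suc v mod m"
    using assms by (auto simp: cycle_adj_def)
  then have "v \<noteq> Suc u" "u \<noteq> Suc v" "u = m - 1 \<Longrightarrow> v \<noteq> 0" "v = m - 1 \<Longrightarrow> u \<noteq> 0"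
    using assms(1,2) by auto
  with False show ?thesis
    by (auto simp: cycle_perm_def intro!: transpose_commute_disjoint)
qed simp

lemma perm_word_simps [simp]:
  "perm_word m [] i = i"
  "perm_word m (l # w) i = cycle_perm m (fst l) (perm_word m w i)"
  "perm_word m (x @ y) i = perm_word m x (perm_word m y i)"
  by (induction x) (simp_all add: perm_word_def)

lemma perm_word_inv_word [simp]: "perm_word m (inv_word w) (perm_word m w i) = i"
  by (induction w arbitrary: i) auto

lemma perm_word_eq:
  assumes "word_eq {..<m} (cycle_adj m) x y"
  shows "perm_word m x i = perm_word m y i"
  using assms
proof (rule word_eq_invariant)
  fix x y
  assume "pres_step {..<m} (cycle_adj m) x y"
  then show "perm_word m x i = perm_word m y i"
  proof cases
    case (comm u v xs a c ys)
    then show ?thesis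
      using cycle_perm_commute[of u m v "perm_word m ys i"] by simp
  qed simp
qed

text \<open>The letters act from \<open>k - 1\<close> down to \<open>0\<close>, each lowering the
  point by one.\<close>

lemma perm_word_staircase:
  assumes "k \<le> m - 3"
  shows "perm_word m (staircase k) (Suc k) = 1"
  using assms
proof (induction k)
  case (Suc k)
  then show ?case by (auto simp: staircase_def cycle_perm_def)
qed (simp add: staircase_def)

lemma perm_word_staircase_fixed:
  assumes "k \<le> m - 3" "i = 0 \<or> Suc k < i"
  shows "perm_word m (staircase k) i = i"
  using assms
proof (induction k)
  case (Suc k)
  then have "k \<noteq> m - 1" "k \<noteq> m - 2" "i \<noteq> k + 1" "i \<noteq> k + 2"
    by auto
  then have "cycle_perm m k i = i"
    by (simp add: cycle_perm_def)
  moreover have "perm_word m (staircase k) i = i"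
    using Suc by auto
  ultimately show ?case
    by (simp add: staircase_def)
qed (simp add: staircase_def)

text \<open>Conjugation by the staircase turns the transposition of \<open>m - 2\<close> and
  \<open>m - 1\<close> into that of \<open>1\<close> and \<open>m - 1\<close>, which does not
  commute with that of \<open>0\<close> and \<open>1\<close>. The point \<open>0\<close> detects
  this.\<close>

lemma commutator_nontrivial:
  assumes m: "3 \<le> m"
  defines "c \<equiv> conj_staircase (m - 3)" and "d \<equiv> [(m - 1, True)]"
  shows "\<not> word_eq {..<m} (cycle_adj m) (c @ d @ inv_word c @ inv_word d) []"
proof
  let ?g = "staircase (m - 3)"
  assume "word_eq {..<m} (cycle_adj m) (c @ d @ inv_word c @ inv_word d) []"
  moreover have "c \<in> words {..<m}" "d \<in> words {..<m}"
    using m by (simp_all add: c_def d_def conj_staircase_words)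
  ultimately have "word_eq {..<m} (cycle_adj m) (c @ d) (d @ c)"
    using word_eq_commutator by blast
  then have eq: "perm_word m (c @ d) 0 = perm_word m (d @ c) 0"
    by (rule perm_word_eq)
  have Suc: "Suc (m - 3) = m - 2" "Suc (m - 2) = m - 1"
    using m by auto
  have g: "perm_word m ?g (m - 2) = 1" "perm_word m ?g (m - 1) = m - 1" "perm_word m ?g 0 = 0"
    using perm_word_staircase[of "m - 3" m] perm_word_staircase_fixed[of "m - 3" m] m
    by (auto simp: Suc)
  have g': "perm_word m (inv_word ?g) 1 = m - 2" "perm_word m (inv_word ?g) 0 = 0"
    using perm_word_inv_word[of m ?g "m - 2"] perm_word_inv_word[of m ?g 0] g by simp_all
  have p: "cycle_perm m (m - 3) = transpose (m - 2) (m - 1)" "cycle_perm m (m - 1) = transpose 0 1"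
    using m Suc by (auto simp: cycle_perm_def)
  have "perm_word m (c @ d) 0 = m - 1"
    using g g' p by (simp add: c_def d_def conj_staircase_def)
  moreover have "perm_word m (d @ c) 0 = 1"
    using g g' p m by (simp add: c_def d_def conj_staircase_def transpose_def)
  ultimately show False
    using eq m by simp
qed

theorem theorem3p16:
  fixes m n :: nat
  assumes "m \<ge> 3" and "n \<ge> 1"
  shows "inj_on (pullback_hom {..<m} (cycle_adj m) {..<n} (path_adj n) (\<lambda>j. j mod m))
            (carrier (pres_group {..<m} (cycle_adj m)))
         \<longleftrightarrow> n \<ge> 2 * m - 2"
proof -
  interpret graph_map "{..<m}" "cycle_adj m" "{..<n}" "path_adj n" "\<lambda>j. j mod m"
    using assms by (intro graph_map_path_cycle) simp
  \<comment> \<open>The commutator of these two words is the kernel element that refutes injectivity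
    when \<open>n < 2 * m - 2\<close>.\<close>
  let ?c = "conj_staircase (m - 3)" and ?d = "[(m - 1, True)]"
  have "?c @ ?d @ inv_word ?c @ inv_word ?d \<in> words {..<m}"
    using assms by (simp add: conj_staircase_words)
  then show ?thesis
    unfolding inj_on_pullback_hom_iff
    using kernel_trivial[of m n] commutator_in_kernel[of m n] commutator_nontrivial[of m] assms(1)
    by (metis not_le)
qed

end
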